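(* Let $H$ be a $\Bbbk$-vector space of dimension $m$ and let $\mathcal H\simeq H\otimes_{\Bbbk}\Bbbk[[u]]$ be a trivialized rank $m$ vector bundle over $\Bbbk[[u]]$. Let $(\mathcal H,\nabla)$ and $(\mathcal H,\nabla')$ be two F-bundles (over a point) framed in the given trivialization, and write $$\nabla_{u\partial_u}=u\partial_u+u^{-1}\mathbf K+\mathbf G,\qquad \nabla'_{u\partial_u}=u\partial_u+u^{-1}\mathbf K'+\mathbf G',$$ with $\mathbf K,\mathbf G,\mathbf K',\mathbf G'\in\mathrm{End}_{\Bbbk}(H)$. Assume that $\mathbf K$ has simple eigenvalues (that is, $m$ pairwise distinct eigenvalues in $\Bbbk$). Then $(\mathcal H,\nabla)$ is isomorphic to $(\mathcal H,\nabla')$ if and only if there exists $\phi\in\mathrm{GL}(H)$ such that (1) $\mathbf K=\phi^{-1}\circ\mathbf K'\circ\phi$, and (2) in an eigenbasis of $\mathbf K$, the diagonal entries satisfy $(\mathbf G)_{ii}=(\phi^{-1}\circ\mathbf G'\circ\phi)_{ii}$ for $1\le i\le m$. Furthermore, the gauge equivalence (isomorphism) $\mathbf\Phi(u)\in\mathrm{GL}(H[[u]])$ between $\nabla$ and $\nabla'$ is uniquely determined by the initial condition $\mathbf\Phi|_{u=0}=\phi$.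
   Context: $\Bbbk$ is a field of characteristic $0$. An F-bundle over a point is a vector bundle $\mathcal H$ over $\mathrm{Spf}\,\Bbbk[[u]]$ (a finite free $\Bbbk[[u]]$-module) with a meromorphic connection $\nabla$ such that $\nabla_{u^2\partial_u}$ is regular. It is framed in a trivialization $\mathcal H\simeq H\otimes\Bbbk[[u]]$ if in this trivialization $\nabla_{u\partial_u}=u\partial_u+u^{-1}\mathbf K+\mathbf G$ with $\mathbf K,\mathbf G\in\mathrm{End}_\Bbbk(H)$ independent of $u$. An isomorphism (gauge equivalence) from $(\mathcal H,\nabla)$ to $(\mathcal H,\nabla')$ is $\mathbf\Phi(u)\in\mathrm{GL}(H[[u]])$, i.e. a $\Bbbk[[u]]$-linear automorphism of $H\otimes\Bbbk[[u]]$, such that $\mathbf\Phi\circ\nabla=\nabla'\circ\mathbf\Phi$. *)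

theory Defs
  imports "HOL-Computational_Algebra.Formal_Laurent_Series"
begin

text \<open>
  The vector space \<open>H\<close> is a type \<open>'h\<close> with a scalar multiplication
  \<open>scale :: 'k \<Rightarrow> 'h \<Rightarrow> 'h\<close>. As \<open>H\<close> is finite dimensional, \<open>H \<otimes> k[[u]] = H[[u]]\<close> and
  \<open>H \<otimes> k((u)) = H((u))\<close>; these are the types \<open>'h fps\<close> and \<open>'h fls\<close>.
\<close>

definition fps_scale ::
    "('k::comm_ring_1 \<Rightarrow> 'h::ab_group_add \<Rightarrow> 'h) \<Rightarrow> 'k fps \<Rightarrow> 'h fps \<Rightarrow> 'h fps" where
  "fps_scale scale f s = Abs_fps (\<lambda>n. \<Sum>i=0..n. scale (fps_nth f i) (fps_nth s (n - i)))"

text \<open>Same pattern as the multiplication of Laurent series in \<open>fls_times_def\<close>.\<close>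

definition fls_scale ::
    "('k::comm_ring_1 \<Rightarrow> 'h::ab_group_add \<Rightarrow> 'h) \<Rightarrow> 'k fls \<Rightarrow> 'h fls \<Rightarrow> 'h fls" where
  "fls_scale scale f s =
     fls_shift (- (fls_subdegree f + fls_subdegree s))
       (fps_to_fls (fps_scale scale (fls_base_factor_to_fps f) (fls_base_factor_to_fps s)))"

text \<open>
  A meromorphic connection is given by its covariant derivative along \<open>\<partial>\<^sub>u\<close>, a map
  \<open>H[[u]] \<Rightarrow> H((u))\<close>; \<open>k\<close>-linearity is the Leibniz rule for constant \<open>f\<close>, together with
  additivity.
\<close>

definition meromorphic_connection ::
    "('k::field_char_0 \<Rightarrow> 'h::ab_group_add \<Rightarrow> 'h) \<Rightarrow> ('h fps \<Rightarrow> 'h fls) \<Rightarrow> bool" where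
  "meromorphic_connection scale nabla \<longleftrightarrow>
     (\<forall>s t. nabla (s + t) = nabla s + nabla t) \<and>
     (\<forall>f s. nabla (fps_scale scale f s) =
        fps_to_fls (fps_scale scale (fps_deriv f) s) + fls_scale scale (fps_to_fls f) (nabla s))"

text \<open>The covariant derivative along the vector field \<open>g(u) \<partial>\<^sub>u\<close>.\<close>

definition covariant_deriv ::
    "('k::field_char_0 \<Rightarrow> 'h::ab_group_add \<Rightarrow> 'h) \<Rightarrow> ('h fps \<Rightarrow> 'h fls) \<Rightarrow> 'k fls \<Rightarrow> 'h fps \<Rightarrow> 'h fls"
  where
  "covariant_deriv scale nabla g s = fls_scale scale g (nabla s)"

definition F_bundle ::
    "('k::field_char_0 \<Rightarrow> 'h::ab_group_add \<Rightarrow> 'h) \<Rightarrow> ('h fps \<Rightarrow> 'h fls) \<Rightarrow> bool" where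
  "F_bundle scale nabla \<longleftrightarrow>
     meromorphic_connection scale nabla \<and>
     (\<forall>s. covariant_deriv scale nabla (fls_X ^ 2) s \<in> range fps_to_fls)"

text \<open>The operator \<open>u \<partial>\<^sub>u\<close> on \<open>H[[u]]\<close> given by the trivialization.\<close>

definition fps_euler ::
    "('k::field_char_0 \<Rightarrow> 'h::ab_group_add \<Rightarrow> 'h) \<Rightarrow> 'h fps \<Rightarrow> 'h fps" where
  "fps_euler scale s = Abs_fps (\<lambda>n. scale (of_nat n) (fps_nth s n))"

text \<open>The \<open>k[[u]]\<close>-linear extension of a \<open>u\<close>-independent endomorphism of \<open>H\<close>.\<close>

definition fps_map :: "('h \<Rightarrow> 'h) \<Rightarrow> 'h fps \<Rightarrow> 'h fps" where
  "fps_map T s = Abs_fps (\<lambda>n. T (fps_nth s n))"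

text \<open>
  The covariant derivative along \<open>u \<partial>\<^sub>u\<close> is \<open>u \<partial>\<^sub>u + u\<^sup>-\<^sup>1 K + G\<close>; \<open>fls_shift 1\<close> is multiplication by \<open>u\<^sup>-\<^sup>1\<close>.
\<close>

definition framed_by ::
    "('k::field_char_0 \<Rightarrow> 'h::ab_group_add \<Rightarrow> 'h) \<Rightarrow> ('h fps \<Rightarrow> 'h fls) \<Rightarrow>
      ('h \<Rightarrow> 'h) \<Rightarrow> ('h \<Rightarrow> 'h) \<Rightarrow> bool" where
  "framed_by scale nabla K G \<longleftrightarrow>
     (\<forall>s. covariant_deriv scale nabla fls_X s =
        fps_to_fls (fps_euler scale s) + fls_shift 1 (fps_to_fls (fps_map K s))
          + fps_to_fls (fps_map G s))"

definition GL :: "('k::field_char_0 \<Rightarrow> 'h::ab_group_add \<Rightarrow> 'h) \<Rightarrow> ('h \<Rightarrow> 'h) set" where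
  "GL scale = {\<phi>. Vector_Spaces.linear scale scale \<phi> \<and> bij \<phi>}"

definition GL_fps ::
    "('k::field_char_0 \<Rightarrow> 'h::ab_group_add \<Rightarrow> 'h) \<Rightarrow> ('h fps \<Rightarrow> 'h fps) set" where
  "GL_fps scale = {\<Phi>. module_hom (fps_scale scale) (fps_scale scale) \<Phi> \<and> bij \<Phi>}"

text \<open>
  The extension of a \<open>k[[u]]\<close>-linear map to \<open>H((u))\<close>: \<open>u\<^sup>d s \<mapsto> u\<^sup>d \<Phi> s\<close> for \<open>s \<in> H[[u]]\<close>.
\<close>

definition fls_extend :: "('h::ab_group_add fps \<Rightarrow> 'h fps) \<Rightarrow> 'h fls \<Rightarrow> 'h fls" where
  "fls_extend \<Phi> s =
     fls_shift (- fls_subdegree s) (fps_to_fls (\<Phi> (fls_base_factor_to_fps s)))"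

definition gauge_equivalence ::
    "('k::field_char_0 \<Rightarrow> 'h::ab_group_add \<Rightarrow> 'h) \<Rightarrow> ('h fps \<Rightarrow> 'h fls) \<Rightarrow> ('h fps \<Rightarrow> 'h fls) \<Rightarrow>
      ('h fps \<Rightarrow> 'h fps) \<Rightarrow> bool" where
  "gauge_equivalence scale nabla nabla' \<Phi> \<longleftrightarrow>
     \<Phi> \<in> GL_fps scale \<and> fls_extend \<Phi> \<circ> nabla = nabla' \<circ> \<Phi>"

definition F_bundles_isomorphic ::
    "('k::field_char_0 \<Rightarrow> 'h::ab_group_add \<Rightarrow> 'h) \<Rightarrow> ('h fps \<Rightarrow> 'h fls) \<Rightarrow> ('h fps \<Rightarrow> 'h fls) \<Rightarrow> bool"
  where
  "F_bundles_isomorphic scale nabla nabla' \<longleftrightarrow> (\<exists>\<Phi>. gauge_equivalence scale nabla nabla' \<Phi>)"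

text \<open>The endomorphism \<open>\<Phi>|\<^sub>u\<^sub>=\<^sub>0\<close> that \<open>\<Phi>\<close> induces on \<open>H = H[[u]] / u H[[u]]\<close>.\<close>

definition at_zero :: "('h::zero fps \<Rightarrow> 'h fps) \<Rightarrow> 'h \<Rightarrow> 'h" where
  "at_zero \<Phi> h = fps_nth (\<Phi> (fps_const h)) 0"

definition eigenvalues ::
    "('k::field \<Rightarrow> 'h::ab_group_add \<Rightarrow> 'h) \<Rightarrow> ('h \<Rightarrow> 'h) \<Rightarrow> 'k set" where
  "eigenvalues scale T = {c. \<exists>v. v \<noteq> 0 \<and> T v = scale c v}"

definition eigenbasis ::
    "('k::field \<Rightarrow> 'h::ab_group_add \<Rightarrow> 'h) \<Rightarrow> ('h \<Rightarrow> 'h) \<Rightarrow> 'h set \<Rightarrow> bool" where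
  "eigenbasis scale T B \<longleftrightarrow>
     \<not> module.dependent scale B \<and> module.span scale B = UNIV \<and>
     (\<forall>b\<in>B. \<exists>c. T b = scale c b)"

text \<open>
  The diagonal entry at \<open>b \<in> B\<close> of the matrix of \<open>T\<close> in the basis \<open>B\<close>: the coefficient of
  \<open>b\<close> in \<open>T b\<close>.
\<close>

definition diag_entry ::
    "('k::field \<Rightarrow> 'h::ab_group_add \<Rightarrow> 'h) \<Rightarrow> 'h set \<Rightarrow> ('h \<Rightarrow> 'h) \<Rightarrow> 'h \<Rightarrow> 'k" where
  "diag_entry scale B T b = module.representation scale B (T b) b"

end

theory Submission
  imports Defs
begin

text \<open>
  Write a \<open>k[[u]]\<close>-linear map as \<open>\<Phi> = \<Sum>P\<^sub>n u\<^sup>n\<close> with linear \<open>P\<^sub>n : H \<Rightarrow> H\<close>. Such a map is invertible iff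
  \<open>P\<^sub>0 = \<Phi>|\<^sub>u\<^sub>=\<^sub>0\<close> is (\<open>bij_fps_op_iff\<close>), and comparing the coefficients of \<open>u\<^sup>n\<^sup>-\<^sup>1\<close> in \<open>\<Phi> \<circ> \<nabla> = \<nabla>' \<circ> \<Phi>\<close>
  turns the gauge equation into a recursion (\<open>gauge_equivalence_fps_op_iff\<close>):
  \<open>K' P\<^sub>0 = P\<^sub>0 K\<close> and \<open>K' P\<^sub>n\<^sub>+\<^sub>1 - P\<^sub>n\<^sub>+\<^sub>1 K = P\<^sub>n G - G' P\<^sub>n - n P\<^sub>n\<close>. Replacing \<open>P\<^sub>n\<close> by
  \<open>P\<^sub>0\<^sup>-\<^sup>1 P\<^sub>n\<close> and \<open>G'\<close> by \<open>P\<^sub>0\<^sup>-\<^sup>1 G' P\<^sub>0\<close>, one may assume \<open>P\<^sub>0 = 1\<close> and \<open>K' = K\<close>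
  (\<open>gauge_recursion_conjugate\<close>); the left-hand side is then the commutator \<open>[K, P\<^sub>n\<^sub>+\<^sub>1]\<close>.

  In an eigenbasis, taking the commutator with \<open>K\<close> multiplies the \<open>(c, b)\<close> entry of a matrix by \<open>\<kappa>\<^sub>c - \<kappa>\<^sub>b\<close>. As
  the eigenvalues are distinct, its kernel consists of the diagonal matrices and its image of those with
  zero diagonal. The recursion thus fixes the off-diagonal part of \<open>P\<^sub>n\<^sub>+\<^sub>1\<close>, provided that the
  right-hand side has zero diagonal. For \<open>n = 0\<close> this proviso says that \<open>G\<close> and \<open>G'\<close> have the same
  diagonal, which is condition (2). Given that, for \<open>n \<ge> 1\<close> the diagonal part of \<open>P\<^sub>n\<close> enters the
  diagonal of \<open>P\<^sub>n G - G' P\<^sub>n - n P\<^sub>n\<close> only through \<open>- n P\<^sub>n\<close>, so that in characteristic 0 the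
  proviso determines the diagonal part of \<open>P\<^sub>n\<close>, which the previous step had left free. Hence the
  normalized recursion has exactly one solution if the diagonals agree and none otherwise
  (\<open>recursion_solution_exists\<close>, \<open>recursion_solution_unique\<close>, \<open>recursion_diag\<close>).
\<close>

unbundle fps_syntax

section \<open>Linear maps over a field of characteristic 0\<close>

locale char_0_space = finite_dimensional_vector_space scale Basis
  for scale :: "'k::field_char_0 \<Rightarrow> 'h::ab_group_add \<Rightarrow> 'h" (infixr \<open>*s\<close> 74) and Basis
begin

abbreviation lin :: "('h \<Rightarrow> 'h) \<Rightarrow> bool" where
  "lin \<equiv> Vector_Spaces.linear scale scale"

lemma lin_iff: "lin f \<longleftrightarrow> (\<forall>x y. f (x + y) = f x + f y) \<and> (\<forall>c x. f (c *s x) = c *s f x)"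
  using vector_space_axioms
  by (auto simp: Vector_Spaces.linear_def module_hom_def module_hom_axioms_def module_axioms)

lemma lin_simps:
  assumes "lin f"
  shows "f (x + y) = f x + f y" "f (c *s x) = c *s f x" "f 0 = 0" "f (- x) = - f x"
    "f (x - y) = f x - f y" "f (sum g A) = (\<Sum>a\<in>A. f (g a))"
proof -
  interpret f: Vector_Spaces.linear scale scale f by fact
  show "f (x + y) = f x + f y" "f (c *s x) = c *s f x" "f 0 = 0" "f (- x) = - f x"
    "f (x - y) = f x - f y" "f (sum g A) = (\<Sum>a\<in>A. f (g a))"
    by (simp_all add: f.add f.scale f.zero f.neg f.diff f.sum)
qed

lemma lin_inv:
  assumes "lin f" "bij f"
  shows "lin (inv f)"
  unfolding lin_iff
proof safe
  have s: "f (inv f x) = x" and i: "inv f (f x) = x" for x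
    using assms(2) by (simp_all add: bij_is_surj surj_f_inv_f bij_is_inj)
  show "inv f (x + y) = inv f x + inv f y" for x y
    by (metis s i lin_simps(1)[OF assms(1)])
  show "inv f (c *s x) = c *s inv f x" for c x
    by (metis s i lin_simps(2)[OF assms(1)])
qed

lemma sum_triangle_swap:
  fixes F :: "nat \<Rightarrow> nat \<Rightarrow> 'b::comm_monoid_add"
  shows "(\<Sum>i=0..n. \<Sum>j=0..n-i. F i j) = (\<Sum>j=0..n. \<Sum>i=0..n-j. F i j)"
  by (auto simp: sum.Sigma intro!: sum.reindex_bij_witness[of _ prod.swap prod.swap])

section \<open>Linear operators on formal power series\<close>

lemma fps_scale_nth: "fps_scale scale f s $ n = (\<Sum>i=0..n. f $ i *s s $ (n - i))"
  by (simp add: fps_scale_def)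

lemma module_fps_scale: "module (fps_scale scale)"
proof
  fix f g :: "'k fps" and s t :: "'h fps"
  show "fps_scale scale f (s + t) = fps_scale scale f s + fps_scale scale f t"
    by (simp add: fps_eq_iff fps_scale_nth scale_right_distrib sum.distrib)
  show "fps_scale scale (f + g) s = fps_scale scale f s + fps_scale scale g s"
    by (simp add: fps_eq_iff fps_scale_nth scale_left_distrib sum.distrib)
  show "fps_scale scale f (fps_scale scale g s) = fps_scale scale (f * g) s"
  proof (rule fps_ext)
    fix n
    show "fps_scale scale f (fps_scale scale g s) $ n = fps_scale scale (f * g) s $ n"
      using fps_mult_assoc_lemma[where f = "\<lambda>i j k. f $ i *s g $ j *s s $ k" and k = n and n = n]
      by (simp add: fps_scale_nth fps_mult_nth scale_sum_left scale_sum_right)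
  qed
  show "fps_scale scale 1 s = s"
  proof (rule fps_ext)
    fix n
    have "fps_scale scale 1 s $ n = (\<Sum>i=0..n. if i = 0 then s $ n else 0)"
      unfolding fps_scale_nth by (rule sum.cong) auto
    then show "fps_scale scale 1 s $ n = s $ n" by simp
  qed
qed

lemma fps_scale_X_power_nth:
  "fps_scale scale (fps_X ^ d) s $ n = (if n < d then 0 else s $ (n - d))"
proof -
  have "fps_scale scale (fps_X ^ d) s $ n = (\<Sum>i=0..n. if i = d then s $ (n - d) else 0)"
    unfolding fps_scale_nth by (rule sum.cong) auto
  then show ?thesis by simp
qed

abbreviation fps_lin :: "('h fps \<Rightarrow> 'h fps) \<Rightarrow> bool" where
  "fps_lin \<equiv> module_hom (fps_scale scale) (fps_scale scale)"

lemma fps_lin_iff: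
  "fps_lin \<Phi> \<longleftrightarrow> (\<forall>s t. \<Phi> (s + t) = \<Phi> s + \<Phi> t) \<and>
     (\<forall>f s. \<Phi> (fps_scale scale f s) = fps_scale scale f (\<Phi> s))"
  by (simp add: module_hom_def module_hom_axioms_def module_fps_scale)

text \<open>The operator \<open>\<Sum>P\<^sub>n u\<^sup>n\<close> on \<open>H[[u]]\<close>.\<close>

definition fps_op :: "(nat \<Rightarrow> 'h \<Rightarrow> 'h) \<Rightarrow> 'h fps \<Rightarrow> 'h fps" where
  "fps_op P s = Abs_fps (\<lambda>n. \<Sum>i=0..n. P i (s $ (n - i)))"

lemma fps_op_nth: "fps_op P s $ n = (\<Sum>i=0..n. P i (s $ (n - i)))"
  by (simp add: fps_op_def)

lemma fps_op_nth_0: "fps_op P s $ 0 = P 0 (s $ 0)"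
  by (simp add: fps_op_nth)

lemma fps_op_nth_head: "fps_op P s $ n = P 0 (s $ n) + (\<Sum>i=1..n. P i (s $ (n - i)))"
  by (simp add: fps_op_nth sum.atLeast_Suc_atMost)

lemma fps_op_const_nth:
  assumes "\<And>i. lin (P i)"
  shows "fps_op P (fps_const h) $ n = P n h"
proof -
  have "fps_op P (fps_const h) $ n = (\<Sum>i=0..n. if i = n then P n h else 0)"
    unfolding fps_op_nth by (rule sum.cong) (auto simp: lin_simps[OF assms])
  then show ?thesis by simp
qed

lemma fps_lin_fps_op:
  assumes "\<And>i. lin (P i)"
  shows "fps_lin (fps_op P)"
  unfolding fps_lin_iff
proof safe
  fix s t :: "'h fps" and f :: "'k fps"
  show "fps_op P (s + t) = fps_op P s + fps_op P t"
    by (simp add: fps_eq_iff fps_op_nth lin_simps[OF assms] sum.distrib)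
  show "fps_op P (fps_scale scale f s) = fps_scale scale f (fps_op P s)"
  proof (rule fps_ext)
    fix n
    have "fps_op P (fps_scale scale f s) $ n
        = (\<Sum>i=0..n. \<Sum>j=0..n-i. f $ j *s P i (s $ (n - i - j)))"
      by (simp add: fps_op_nth fps_scale_nth lin_simps[OF assms])
    also have "\<dots> = (\<Sum>j=0..n. \<Sum>i=0..n-j. f $ j *s P i (s $ (n - i - j)))"
      by (rule sum_triangle_swap)
    also have "\<dots> = fps_scale scale f (fps_op P s) $ n"
      by (simp add: fps_op_nth fps_scale_nth scale_sum_right add.commute)
    finally show "fps_op P (fps_scale scale f s) $ n = fps_scale scale f (fps_op P s) $ n" .
  qed
qed

text \<open>
  A \<open>k[[u]]\<close>-linear map preserves \<open>u\<^sup>n H[[u]]\<close> and hence is continuous in the \<open>u\<close>-adic topology, so it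
  is determined by its values on constants, whose coefficients are the \<open>P\<^sub>n\<close>.
\<close>

lemma fps_lin_eq_fps_op:
  assumes "fps_lin \<Phi>"
  obtains P where "\<And>i. lin (P i)" "\<Phi> = fps_op P"
proof
  interpret \<Phi>: module_hom "fps_scale scale" "fps_scale scale" \<Phi> by fact
  define P where "P = (\<lambda>i h. \<Phi> (fps_const h) $ i)"
  show "lin (\<lambda>h. \<Phi> (fps_const h) $ i)" for i
    unfolding lin_iff
  proof safe
    show "\<Phi> (fps_const (x + y)) $ i = \<Phi> (fps_const x) $ i + \<Phi> (fps_const y) $ i" for x y
      by (simp flip: fps_const_add add: \<Phi>.add)
    have const: "fps_scale scale (fps_const c) s = Abs_fps (\<lambda>n. c *s s $ n)" for c s
    proof (rule fps_ext)
      fix n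
      have "fps_scale scale (fps_const c) s $ n = (\<Sum>i=0..n. if i = 0 then c *s s $ n else 0)"
        unfolding fps_scale_nth by (rule sum.cong) auto
      then show "fps_scale scale (fps_const c) s $ n = Abs_fps (\<lambda>n. c *s s $ n) $ n" by simp
    qed
    have scaled: "fps_const (c *s x) = fps_scale scale (fps_const c) (fps_const x)" for c x
      by (simp add: const fps_eq_iff)
    show "\<Phi> (fps_const (c *s x)) $ i = c *s \<Phi> (fps_const x) $ i" for c x
      by (simp only: scaled \<Phi>.scale) (simp add: const)
  qed
  show "\<Phi> = fps_op (\<lambda>i h. \<Phi> (fps_const h) $ i)"
  proof
    fix s
    \<comment> \<open>Peel off the constant term: \<open>s = s\<^sub>0 + u s'\<close> gives \<open>\<Phi> s = \<Phi> s\<^sub>0 + u \<Phi> s'\<close>.\<close>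
    have peel: "\<Phi> s = \<Phi> (fps_const (s $ 0)) + fps_scale scale (fps_X ^ 1) (\<Phi> (fps_shift 1 s))" for s
    proof -
      have "s = fps_const (s $ 0) + fps_scale scale (fps_X ^ 1) (fps_shift 1 s)"
        unfolding fps_eq_iff fps_add_nth fps_scale_X_power_nth by auto
      then show ?thesis by (metis \<Phi>.add \<Phi>.scale)
    qed
    have "\<Phi> s $ n = (\<Sum>i=0..n. P i (s $ (n - i)))" for n
    proof (induction n arbitrary: s)
      case (0 s)
      show ?case
        by (subst peel, unfold fps_add_nth fps_scale_X_power_nth) (simp add: P_def)
    next
      case (Suc n s)
      have "\<Phi> s $ Suc n = P (Suc n) (s $ 0) + \<Phi> (fps_shift 1 s) $ n"
        by (subst peel, unfold fps_add_nth fps_scale_X_power_nth) (simp add: P_def)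
      also have "\<Phi> (fps_shift 1 s) $ n = (\<Sum>i=0..n. P i (s $ (Suc n - i)))"
        unfolding Suc.IH by (rule sum.cong) (auto simp: Suc_diff_le)
      finally show ?case by (simp add: add.commute)
    qed
    then show "\<Phi> s = fps_op (\<lambda>i h. \<Phi> (fps_const h) $ i) s"
      by (simp add: fps_eq_iff fps_op_nth P_def)
  qed
qed

text \<open>
  The coefficients of the preimage of \<open>t\<close> under \<open>\<Sum>P\<^sub>n u\<^sup>n\<close>, by successive elimination.
\<close>

fun fps_op_solve :: "(nat \<Rightarrow> 'h \<Rightarrow> 'h) \<Rightarrow> 'h fps \<Rightarrow> nat \<Rightarrow> 'h" where
  "fps_op_solve P t n = inv (P 0) (t $ n - (\<Sum>i=1..n. P i (fps_op_solve P t (n - i))))"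

declare fps_op_solve.simps [simp del]

text \<open>
  The coefficient of \<open>u\<^sup>n\<close> in \<open>\<Phi> s\<close> is \<open>P\<^sub>0 s\<^sub>n\<close> plus terms in \<open>s\<^sub>0, \<dots>, s\<^sub>n\<^sub>-\<^sub>1\<close>, so that \<open>\<Phi> s = t\<close> can be
  solved recursively, and uniquely, once \<open>P\<^sub>0\<close> is invertible. Conversely an invertible \<open>\<Phi>\<close> induces an
  invertible map on \<open>H[[u]] / u H[[u]]\<close>.
\<close>

lemma bij_fps_op_iff:
  assumes "\<And>i. lin (P i)"
  shows "bij (fps_op P) \<longleftrightarrow> bij (P 0)"
proof
  assume bij: "bij (P 0)"
  have "inj (fps_op P)"
  proof (rule injI)
    fix s t assume eq: "fps_op P s = fps_op P t"
    have "s $ n = t $ n" for n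
    proof (induction n rule: less_induct)
      case (less n)
      have "(\<Sum>i=1..n. P i (s $ (n - i))) = (\<Sum>i=1..n. P i (t $ (n - i)))"
        using less by (intro sum.cong) auto
      moreover have "fps_op P s $ n = fps_op P t $ n" using eq by simp
      ultimately have "P 0 (s $ n) = P 0 (t $ n)" by (simp add: fps_op_nth_head)
      then show ?case using bij by (simp add: bij_is_inj inj_eq)
    qed
    then show "s = t" by (simp add: fps_eq_iff)
  qed
  moreover have "fps_op P (Abs_fps (fps_op_solve P t)) = t" for t
  proof (rule fps_ext)
    fix n
    have "P 0 (fps_op_solve P t n) = t $ n - (\<Sum>i=1..n. P i (fps_op_solve P t (n - i)))"
      by (subst fps_op_solve.simps) (simp add: bij bij_is_surj surj_f_inv_f)
    then show "fps_op P (Abs_fps (fps_op_solve P t)) $ n = t $ n"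
      by (simp add: fps_op_nth_head)
  qed
  then have "surj (fps_op P)" by (rule surjI)
  ultimately show "bij (fps_op P)" by (simp add: bij_def)
next
  assume bij: "bij (fps_op P)"
  interpret \<Phi>: module_hom "fps_scale scale" "fps_scale scale" "fps_op P"
    by (rule fps_lin_fps_op[OF assms])
  have "surj (P 0)"
  proof (rule surjI)
    fix h
    have "fps_op P (inv (fps_op P) (fps_const h)) = fps_const h"
      using bij by (simp add: bij_is_surj surj_f_inv_f)
    then show "P 0 (inv (fps_op P) (fps_const h) $ 0) = h"
      by (metis fps_op_nth_0 fps_nth_fps_const)
  qed
  moreover have "h = 0" if "P 0 h = 0" for h
  proof -
    \<comment> \<open>\<open>\<Phi> h\<close> is divisible by \<open>u\<close>; apply the inverse of \<open>\<Phi>\<close> to see that the constant \<open>h\<close> is, too.\<close>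
    let ?t = "fps_op P (fps_const h)"
    obtain s where s: "fps_op P s = fps_shift 1 ?t"
      using bij by (metis bij_pointE)
    have "?t = fps_scale scale (fps_X ^ 1) (fps_shift 1 ?t)"
      using that by (auto simp only: fps_eq_iff fps_scale_X_power_nth)
        (simp add: fps_op_nth_0)
    then have "?t = fps_op P (fps_scale scale (fps_X ^ 1) s)"
      by (simp add: \<Phi>.scale s)
    then have "fps_const h = fps_scale scale (fps_X ^ 1) s"
      using bij by (meson bij_is_inj injD)
    then have "fps_const h $ 0 = fps_scale scale (fps_X ^ 1) s $ 0" by simp
    then show ?thesis unfolding fps_scale_X_power_nth by simp
  qed
  then have "x = y" if "P 0 x = P 0 y" for x y
    using that lin_simps(5)[OF assms, of 0 x y] by (metis diff_self right_minus_eq)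
  then have "inj (P 0)" by (rule injI)
  ultimately show "bij (P 0)" by (simp add: bij_def)
qed

section \<open>The gauge equation as a recursion\<close>

text \<open>
  The definition of the extension to \<open>H((u))\<close> uses the representation of a Laurent series with
  exact leading exponent; by linearity any representation \<open>u\<^sup>-\<^sup>k s\<close> gives the same result.
\<close>

lemma fls_extend_fls_shift:
  assumes "fps_lin \<Phi>"
  shows "fls_extend \<Phi> (fls_shift k (fps_to_fls s)) = fls_shift k (fps_to_fls (\<Phi> s))"
proof (cases "s = 0")
  case True
  then show ?thesis
    using module_hom.zero[OF assms] by (simp add: fls_extend_def)
next
  case False
  define d where "d = subdegree s"
  define t where "t = fps_shift d s"
  have s: "s = fps_scale scale (fps_X ^ d) t"
    unfolding fps_eq_iff fps_scale_X_power_nth by (auto simp: t_def d_def)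
  have "fls_base_factor_to_fps (fls_shift k (fps_to_fls s)) = t"
    using False by (simp add: t_def d_def fls_subdegree_fls_to_fps fps_eq_iff flip: of_nat_add)
  moreover have "fls_subdegree (fls_shift k (fps_to_fls s)) = int d - k"
    using False by (simp add: d_def fls_subdegree_fls_to_fps)
  ultimately have "fls_extend \<Phi> (fls_shift k (fps_to_fls s))
      = fls_shift (k - int d) (fps_to_fls (\<Phi> t))"
    by (simp add: fls_extend_def)
  also have "\<dots> = fls_shift k (fps_to_fls (fps_scale scale (fps_X ^ d) (\<Phi> t)))"
  proof (rule fls_eqI)
    fix n
    have "nat (n + (k - int d)) = nat (n + k) - d" by linarith
    then show "fls_shift (k - int d) (fps_to_fls (\<Phi> t)) $$ n
        = fls_shift k (fps_to_fls (fps_scale scale (fps_X ^ d) (\<Phi> t))) $$ n"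
      by (auto simp: fps_scale_X_power_nth nat_less_iff)
  qed
  also have "fps_scale scale (fps_X ^ d) (\<Phi> t) = \<Phi> s"
    by (simp add: s module_hom.scale[OF assms])
  finally show ?thesis .
qed

lemma fls_scale_X: "fls_scale scale fls_X t = fls_shift (- 1) t"
proof -
  have "fps_scale scale 1 s = s" for s
    using module_fps_scale by (simp add: module_def)
  then have "fls_scale scale fls_X t =
      fls_shift (- (1 + fls_subdegree t)) (fps_to_fls (fls_base_factor_to_fps t))"
    by (simp add: fls_scale_def)
  also have "\<dots> = fls_shift (- 1) t"
    by (rule fls_eqI) (auto simp: algebra_simps intro!: fls_eq0_below_subdegree)
  finally show ?thesis .
qed

text \<open>
  The operator \<open>u\<^sup>2 \<partial>\<^sub>u + K + u G = u (u \<partial>\<^sub>u + u\<^sup>-\<^sup>1 K + G)\<close>. It maps \<open>H[[u]]\<close> to itself, so that the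
  gauge equation can be compared coefficient by coefficient without negative exponents.
\<close>

definition framed_op :: "('h \<Rightarrow> 'h) \<Rightarrow> ('h \<Rightarrow> 'h) \<Rightarrow> 'h fps \<Rightarrow> 'h fps" where
  "framed_op K G s =
     Abs_fps (\<lambda>n. K (s $ n) +
       (case n of 0 \<Rightarrow> 0 | Suc j \<Rightarrow> of_nat j *s s $ j + G (s $ j)))"

lemma framed_by_nabla:
  assumes "framed_by scale nabla K G"
  shows "nabla s = fls_shift 2 (fps_to_fls (framed_op K G s))"
proof -
  have "fls_shift (- 1) (nabla s) = fps_to_fls (fps_euler scale s)
      + fls_shift 1 (fps_to_fls (fps_map K s)) + fps_to_fls (fps_map G s)"
    using assms by (simp add: framed_by_def covariant_deriv_def fls_scale_X)
  also have "\<dots> = fls_shift 1 (fps_to_fls (framed_op K G s))"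
  proof (rule fls_eqI)
    fix n :: int
    consider "n < -1" | "n = -1" | "n = int (nat n)" by linarith
    then show "(fps_to_fls (fps_euler scale s) + fls_shift 1 (fps_to_fls (fps_map K s))
        + fps_to_fls (fps_map G s)) $$ n = fls_shift 1 (fps_to_fls (framed_op K G s)) $$ n"
    proof cases
      case 3
      then have "nat (n + 1) = Suc (nat n)" "\<not> n < 0" "\<not> n + 1 < 0" by linarith+
      then show ?thesis by (simp add: framed_op_def fps_euler_def fps_map_def)
    qed (simp_all add: framed_op_def fps_euler_def fps_map_def)
  qed
  finally have "fls_shift 1 (fls_shift (- 1) (nabla s)) = fls_shift 1 \<dots>" by simp
  then show ?thesis by simp
qed

text \<open>
  The coefficients of \<open>u\<^sup>-\<^sup>1\<close> and of \<open>u\<^sup>n\<close>, \<open>n \<ge> 0\<close>, in the gauge equation for \<open>\<Phi> = \<Sum>P\<^sub>n u\<^sup>n\<close>.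
\<close>

definition gauge_recursion ::
    "('h \<Rightarrow> 'h) \<Rightarrow> ('h \<Rightarrow> 'h) \<Rightarrow> ('h \<Rightarrow> 'h) \<Rightarrow> ('h \<Rightarrow> 'h) \<Rightarrow> (nat \<Rightarrow> 'h \<Rightarrow> 'h) \<Rightarrow> bool" where
  "gauge_recursion K G K' G' P \<longleftrightarrow>
     (\<forall>h. K' (P 0 h) = P 0 (K h)) \<and>
     (\<forall>n h. K' (P (Suc n) h) - P (Suc n) (K h) = P n (G h) - G' (P n h) - of_nat n *s P n h)"

text \<open>
  Evaluating at constants gives the recursion. Conversely, in the coefficient of \<open>u\<^sup>n\<close> at a general
  \<open>s\<close> each \<open>K' P\<^sub>i\<^sub>+\<^sub>1 - P\<^sub>i\<^sub>+\<^sub>1 K\<close> meets the right-hand side of its recursion step at the same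
  argument; the weights \<open>n - 1 - i\<close> and \<open>n - 1\<close> coming from \<open>u\<^sup>2 \<partial>\<^sub>u\<close> before and after \<open>\<Phi>\<close> differ by
  the \<open>i\<close> of the recursion.
\<close>

lemma fps_op_intertwines_iff:
  assumes P: "\<And>i. lin (P i)" and K': "lin K'" and G': "lin G'"
    and K: "lin K" and G: "lin G"
  shows "(\<forall>s. fps_op P (framed_op K G s) = framed_op K' G' (fps_op P s)) \<longleftrightarrow>
    gauge_recursion K G K' G' P"
proof
  assume eq: "\<forall>s. fps_op P (framed_op K G s) = framed_op K' G' (fps_op P s)"
  have L: "fps_op P (framed_op K G (fps_const h)) $ n
      = P n (K h) + (case n of 0 \<Rightarrow> 0 | Suc j \<Rightarrow> P j (G h))" for h n
  proof -
    have "framed_op K G (fps_const h) $ k =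
        (if k = 0 then K h else if k = 1 then G h else 0)" for k
      by (auto simp: framed_op_def lin_simps[OF K] lin_simps[OF G] split: nat.splits)
    then have "fps_op P (framed_op K G (fps_const h)) $ n =
       (\<Sum>i=0..n. (if i = n then P n (K h) else 0) + (if Suc i = n then P i (G h) else 0))"
      unfolding fps_op_nth by (intro sum.cong) (auto simp: lin_simps[OF P])
    also have "\<dots> = P n (K h) + (case n of 0 \<Rightarrow> 0 | Suc j \<Rightarrow> P j (G h))"
      by (cases n) (auto simp: sum.distrib)
    finally show ?thesis .
  qed
  have "P n (K h) + (case n of 0 \<Rightarrow> 0 | Suc j \<Rightarrow> P j (G h)) =
      K' (P n h) + (case n of 0 \<Rightarrow> 0 | Suc j \<Rightarrow> of_nat j *s P j h + G' (P j h))" for n h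
    unfolding L[symmetric] eq[rule_format]
    by (simp add: framed_op_def fps_op_const_nth[OF P] cong: nat.case_cong)
  note this[of 0] this[of "Suc _"]
  then show "gauge_recursion K G K' G' P"
    unfolding gauge_recursion_def by (auto simp: algebra_simps)
next
  assume rec: "gauge_recursion K G K' G' P"
  show "\<forall>s. fps_op P (framed_op K G s) = framed_op K' G' (fps_op P s)"
  proof (intro allI fps_ext)
    fix s n
    show "fps_op P (framed_op K G s) $ n = framed_op K' G' (fps_op P s) $ n"
    proof (cases n)
      case 0
      then show ?thesis
        using rec by (simp add: framed_op_def fps_op_nth gauge_recursion_def)
    next
      case (Suc m)
      let ?D = "\<lambda>i h. K' (P i h) - P i (K h)"
      have "fps_op P (framed_op K G s) $ n = (\<Sum>i=0..n. P i (K (s $ (n - i))))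
          + (\<Sum>i=0..m. P i (of_nat (m - i) *s s $ (m - i) + G (s $ (m - i))))"
      proof -
        have "(\<Sum>i=0..m. P i (framed_op K G s $ (n - i))) =
          (\<Sum>i=0..m. P i (K (s $ (n - i))) + P i (of_nat (m - i) *s s $ (m - i) + G (s $ (m - i))))"
          by (rule sum.cong) (auto simp: Suc Suc_diff_le framed_op_def lin_simps[OF P])
        then show ?thesis
          by (simp add: fps_op_nth Suc sum.distrib) (simp add: framed_op_def)
      qed
      moreover have "framed_op K' G' (fps_op P s) $ n = (\<Sum>i=0..n. K' (P i (s $ (n - i))))
          + (\<Sum>i=0..m. of_nat m *s P i (s $ (m - i)) + G' (P i (s $ (m - i))))"
        by (simp add: Suc framed_op_def fps_op_nth lin_simps[OF K'] lin_simps[OF G']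
          sum.distrib scale_sum_right scale_right_distrib)
      moreover have "(\<Sum>i=0..n. ?D i (s $ (n - i))) = (\<Sum>i=0..m.
          P i (of_nat (m - i) *s s $ (m - i) + G (s $ (m - i)))
          - (of_nat m *s P i (s $ (m - i)) + G' (P i (s $ (m - i)))))"
      proof -
        have "(\<Sum>i=0..n. ?D i (s $ (n - i))) = (\<Sum>i=0..m. ?D (Suc i) (s $ (m - i)))"
          using rec unfolding Suc
          by (subst sum.atLeast0_atMost_Suc_shift) (simp add: gauge_recursion_def)
        also have "\<dots> = (\<Sum>i=0..m.
          P i (of_nat (m - i) *s s $ (m - i) + G (s $ (m - i)))
          - (of_nat m *s P i (s $ (m - i)) + G' (P i (s $ (m - i)))))"
        proof (rule sum.cong)
          fix i assume "i \<in> {0..m}"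
          then have "(of_nat m :: 'k) = of_nat (m - i) + of_nat i"
            by (simp flip: of_nat_add)
          then show "?D (Suc i) (s $ (m - i)) = P i (of_nat (m - i) *s s $ (m - i) + G (s $ (m - i)))
              - (of_nat m *s P i (s $ (m - i)) + G' (P i (s $ (m - i))))"
            using rec by (simp add: gauge_recursion_def lin_simps[OF P] scale_left_distrib)
        qed simp
        finally show ?thesis .
      qed
      ultimately show ?thesis
        by (simp add: sum_subtractf algebra_simps)
    qed
  qed
qed

lemma gauge_equivalence_fps_op_iff:
  assumes "\<And>i. lin (P i)" "lin K'" "lin G'" "lin K" "lin G"
    and "framed_by scale nabla K G" "framed_by scale nabla' K' G'"
  shows "gauge_equivalence scale nabla nabla' (fps_op P) \<longleftrightarrow>
    bij (P 0) \<and> gauge_recursion K G K' G' P"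
proof -
  have inj: "fls_shift 2 (fps_to_fls s) = fls_shift 2 (fps_to_fls t) \<longleftrightarrow> s = t" for s t :: "'h fps"
  proof
    assume "fls_shift 2 (fps_to_fls s) = fls_shift 2 (fps_to_fls t)"
    from arg_cong[OF this, of "\<lambda>x. fls_regpart (fls_shift (- 2) x)"] show "s = t" by simp
  qed simp
  have "fls_extend (fps_op P) \<circ> nabla = nabla' \<circ> fps_op P \<longleftrightarrow>
      (\<forall>s. fps_op P (framed_op K G s) = framed_op K' G' (fps_op P s))"
    by (simp add: fun_eq_iff inj framed_by_nabla[OF assms(6)] framed_by_nabla[OF assms(7)]
      fls_extend_fls_shift[OF fps_lin_fps_op[OF assms(1)]])
  then show ?thesis
    by (simp add: gauge_equivalence_def GL_fps_def bij_fps_op_iff fps_lin_fps_op assms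
      fps_op_intertwines_iff)
qed

lemma at_zero_fps_op: "at_zero (fps_op P) = P 0"
  by (simp add: fun_eq_iff at_zero_def fps_op_nth)

section \<open>Eigenbases of an operator with simple spectrum\<close>

text \<open>
  Applying \<open>K - c\<close> to the relation \<open>v = \<Sum>u\<^sub>b b\<close> multiplies each coefficient by \<open>\<kappa>\<^sub>b - c\<close>, and
  the result must vanish.
\<close>

lemma eigenvector_combination:
  assumes K: "lin K" and S: "independent S" and \<kappa>: "\<And>b. b \<in> S \<Longrightarrow> K b = \<kappa> b *s b"
    and eigen: "K (\<Sum>b\<in>S. u b *s b) = c *s (\<Sum>b\<in>S. u b *s b)" and b: "b \<in> S"
  shows "u b = 0 \<or> \<kappa> b = c"
proof -
  have "K (\<Sum>b\<in>S. u b *s b) = (\<Sum>b\<in>S. (u b * \<kappa> b) *s b)"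
    unfolding lin_simps[OF K] by (rule sum.cong) (use \<kappa> in auto)
  then have "(\<Sum>b\<in>S. (u b * (\<kappa> b - c)) *s b) = 0"
    using eigen by (simp add: scale_sum_right algebra_simps sum_subtractf)
  then have "u b * (\<kappa> b - c) = 0"
    using S[unfolded independent_explicit, THEN conjunct2, rule_format,
        of "\<lambda>b. u b * (\<kappa> b - c)" b] b by simp
  then show ?thesis by simp
qed

lemma independent_if_distinct_eigenvalues:
  assumes K: "lin K" and "finite S"
    and "\<And>v. v \<in> S \<Longrightarrow> v \<noteq> 0 \<and> K v = \<kappa> v *s v" and "inj_on \<kappa> S"
  shows "independent S"
  using assms(2-)
proof (induction S)
  case (insert a S)
  have ind: "independent S" using insert by auto
  have "a \<notin> span S"
  proof
    assume "a \<in> span S"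
    then obtain u where a: "a = (\<Sum>v\<in>S. u v *s v)"
      using span_finite[OF insert.hyps(1)] by auto
    have "K a = \<kappa> a *s a" using insert.prems(1) by simp
    then have "u v = 0 \<or> \<kappa> v = \<kappa> a" if "v \<in> S" for v
      using eigenvector_combination[OF K ind, of \<kappa> u "\<kappa> a" v] insert.prems(1) that a by auto
    moreover have "\<kappa> v \<noteq> \<kappa> a" if "v \<in> S" for v
      using insert.hyps(2) insert.prems(2) that by (auto simp: inj_on_def)
    ultimately have "a = 0" by (subst a, intro sum.neutral) auto
    then show False using insert.prems(1) by simp
  qed
  then show ?case using ind by (simp add: independent_insert)
qed (simp add: independent_empty)

lemma eigenbasis_exists:
  assumes "lin K" and card: "card (eigenvalues scale K) = dim UNIV"
  shows "\<exists>B. eigenbasis scale K B"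
proof -
  define v where "v c = (SOME v. v \<noteq> 0 \<and> K v = c *s v)" for c
  have v: "v c \<noteq> 0 \<and> K (v c) = c *s v c" if "c \<in> eigenvalues scale K" for c
    using that someI_ex[of "\<lambda>v. v \<noteq> 0 \<and> K v = c *s v"]
    by (auto simp: eigenvalues_def v_def)
  \<comment> \<open>The cardinality of an infinite set is 0, so that \<open>card\<close> does not give finiteness if
    \<open>dim UNIV = 0\<close>; then \<open>E = {}\<close> serves.\<close>
  obtain E where E: "E \<subseteq> eigenvalues scale K" "finite E" "card E = dim UNIV"
    by (metis card card.infinite card.empty empty_subsetI finite.emptyI order_refl)
  have inj: "inj_on v E"
  proof (rule inj_onI)
    fix c d assume "c \<in> E" "d \<in> E" "v c = v d"
    then have "c *s v c = d *s v c" "v c \<noteq> 0" using v E(1) by (metis subsetD)+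
    then show "c = d" by simp
  qed
  have "independent (v ` E)"
  proof (rule independent_if_distinct_eigenvalues[OF \<open>lin K\<close>, where \<kappa> = "inv_into E v"])
    show "w \<noteq> 0 \<and> K w = inv_into E v w *s w" if "w \<in> v ` E" for w
      using that v E(1) by (auto simp: inv_into_f_f[OF inj])
    show "inj_on (inv_into E v) (v ` E)" by (simp add: inj_on_inv_into)
  qed (simp add: E)
  moreover have "span (v ` E) = UNIV"
    using card_ge_dim_independent[OF _ calculation, of UNIV] E(3) by (auto simp: card_image[OF inj])
  moreover have "\<forall>b\<in>v ` E. \<exists>c. K b = c *s b" using v E(1) by blast
  ultimately show ?thesis unfolding eigenbasis_def by blast
qed

text \<open>
  Every eigenvalue occurs at some basis vector, so \<open>\<kappa>\<close> maps the \<open>m\<close> elements of \<open>B\<close> onto a set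
  containing all \<open>m\<close> eigenvalues.
\<close>

lemma eigenbasis_distinct_eigenvalues:
  assumes K: "lin K" and card: "card (eigenvalues scale K) = dim UNIV"
    and B: "independent B" "span B = UNIV" and \<kappa>: "\<And>b. b \<in> B \<Longrightarrow> K b = \<kappa> b *s b"
  shows "inj_on \<kappa> B"
proof -
  have fin: "finite B" by (rule finiteI_independent[OF B(1)])
  have "eigenvalues scale K \<subseteq> \<kappa> ` B"
  proof
    fix c assume "c \<in> eigenvalues scale K"
    then obtain v where v: "v \<noteq> 0" "K v = c *s v" by (auto simp: eigenvalues_def)
    obtain u where u: "v = (\<Sum>b\<in>B. u b *s b)"
      using B(2) span_finite[OF fin] by auto
    have "u b = 0 \<or> \<kappa> b = c" if "b \<in> B" for b
      using eigenvector_combination[OF K B(1) \<kappa>, where u = u and c = c] v(2) that by (simp flip: u)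
    moreover obtain b where "b \<in> B" "u b \<noteq> 0"
      using v(1) u by (metis (no_types, lifting) scale_zero_left sum.neutral)
    ultimately show "c \<in> \<kappa> ` B" by blast
  qed
  then have "card B \<le> card (\<kappa> ` B)"
    using card card_mono[of "\<kappa> ` B" "eigenvalues scale K"] fin dim_eq_card[OF _ B(1), of UNIV]
    by (simp add: B(2))
  then show ?thesis
    using fin card_image_le[OF fin, of \<kappa>] by (intro eq_card_imp_inj_on) auto
qed

end

locale simple_spectrum = char_0_space +
  fixes K :: "'b \<Rightarrow> 'b" and B :: "'b set" and \<kappa> :: "'b \<Rightarrow> 'a"
  assumes lin_K: "lin K"
    and independent_B: "independent B" and span_B: "span B = UNIV"
    and K_eigen: "b \<in> B \<Longrightarrow> K b = \<kappa> b *s b"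
    and inj_\<kappa>: "inj_on \<kappa> B"
begin

lemma finite_B: "finite B"
  by (rule finiteI_independent[OF independent_B])

abbreviation coord :: "'b \<Rightarrow> 'b \<Rightarrow> 'a" where
  "coord \<equiv> representation B"

lemma coord_simps:
  "coord (v + w) c = coord v c + coord w c" "coord (v - w) c = coord v c - coord w c"
  "coord (r *s v) c = r * coord v c" "coord 0 c = 0"
  by (simp_all add: representation_add representation_diff representation_scale
    representation_zero independent_B span_B)

lemma coord_sum: "coord (sum f A) c = (\<Sum>a\<in>A. coord (f a) c)"
  by (simp add: representation_sum independent_B span_B)

lemma coord_basis: "b \<in> B \<Longrightarrow> coord b c = (if c = b then 1 else 0)"
  by (simp add: representation_basis independent_B)

lemma expand: "(\<Sum>b\<in>B. coord v b *s b) = v"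
  by (rule sum_representation_eq) (simp_all add: independent_B span_B finite_B)

lemma lin_eqI:
  assumes "lin f" "lin g" "\<And>b. b \<in> B \<Longrightarrow> f b = g b"
  shows "f h = g h"
proof -
  interpret vector_space_pair scale scale ..
  show ?thesis by (rule linear_eq_on[OF assms(1,2) _ assms(3)]) (simp_all add: span_B)
qed

lemma lin_extend: "\<exists>f. lin f \<and> (\<forall>b\<in>B. f b = g b)"
proof -
  interpret vector_space_pair scale scale ..
  show ?thesis using linear_independent_extend[OF independent_B, of g] by auto
qed

lemma coord_diagonal:
  assumes "lin D" "\<And>b. b \<in> B \<Longrightarrow> D b = d b *s b" "c \<in> B"
  shows "coord (D v) c = d c * coord v c"
proof -
  have "coord (D v) c = (\<Sum>b\<in>B. coord v b * coord (D b) c)"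
    by (subst (1) expand[symmetric, of v])
      (simp add: lin_simps[OF assms(1)] coord_sum coord_simps)
  also have "\<dots> = (\<Sum>b\<in>B. if b = c then d c * coord v c else 0)"
    by (rule sum.cong) (auto simp: assms(2) coord_simps coord_basis)
  finally show ?thesis using assms(3) finite_B by simp
qed

lemma coord_K: "c \<in> B \<Longrightarrow> coord (K v) c = \<kappa> c * coord v c"
  by (rule coord_diagonal[OF lin_K K_eigen])

section \<open>The commutator with an operator of simple spectrum\<close>

lemma coord_commutator:
  assumes "lin T" "b \<in> B" "c \<in> B"
  shows "coord (K (T b) - T (K b)) c = (\<kappa> c - \<kappa> b) * coord (T b) c"
  unfolding K_eigen[OF \<open>b \<in> B\<close>] lin_simps(2)[OF \<open>lin T\<close>] coord_simps
    coord_K[OF \<open>c \<in> B\<close>]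
  by (rule left_diff_distrib[symmetric])

text \<open>
  Dividing the off-diagonal entries of \<open>R\<close> by the nonzero numbers \<open>\<kappa>\<^sub>c - \<kappa>\<^sub>b\<close> gives a solution; the one
  with zero diagonal is chosen.
\<close>

lemma commutator_surj_off_diagonal:
  assumes R: "lin R" and diag: "\<And>b. b \<in> B \<Longrightarrow> coord (R b) b = 0"
  obtains P where "lin P" "\<And>h. K (P h) - P (K h) = R h"
proof -
  obtain P where P: "lin P"
    and Pb: "\<And>b. b \<in> B \<Longrightarrow> P b = (\<Sum>c\<in>B - {b}. (coord (R b) c / (\<kappa> c - \<kappa> b)) *s c)"
    using lin_extend[of "\<lambda>b. \<Sum>c\<in>B - {b}. (coord (R b) c / (\<kappa> c - \<kappa> b)) *s c"] by blast
  have "K (P b) - P (K b) = R b" if "b \<in> B" for b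
  proof -
    have "K (P b) - P (K b) = (\<Sum>c\<in>B - {b}. (coord (R b) c / (\<kappa> c - \<kappa> b)) *s K c
        - \<kappa> b *s ((coord (R b) c / (\<kappa> c - \<kappa> b)) *s c))"
      by (simp add: K_eigen[OF that] lin_simps[OF P] lin_simps[OF lin_K] Pb[OF that]
        scale_sum_right sum_subtractf)
    also have "\<dots> = (\<Sum>c\<in>B - {b}. coord (R b) c *s c)"
    proof (rule sum.cong)
      fix c assume c: "c \<in> B - {b}"
      then have "\<kappa> c - \<kappa> b \<noteq> 0" using inj_\<kappa> that by (auto simp: inj_on_def)
      then have "coord (R b) c / (\<kappa> c - \<kappa> b) * \<kappa> c - \<kappa> b * (coord (R b) c / (\<kappa> c - \<kappa> b))
          = coord (R b) c / (\<kappa> c - \<kappa> b) * (\<kappa> c - \<kappa> b)"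
        by (simp only: right_diff_distrib mult.commute[of "\<kappa> b"])
      also have "\<dots> = coord (R b) c"
        using \<open>\<kappa> c - \<kappa> b \<noteq> 0\<close> by simp
      finally have "coord (R b) c / (\<kappa> c - \<kappa> b) * \<kappa> c
          - \<kappa> b * (coord (R b) c / (\<kappa> c - \<kappa> b)) = coord (R b) c" .
      with c show "(coord (R b) c / (\<kappa> c - \<kappa> b)) *s K c
          - \<kappa> b *s ((coord (R b) c / (\<kappa> c - \<kappa> b)) *s c) = coord (R b) c *s c"
        by (simp only: K_eigen[of c] DiffD1 scale_scale flip: scale_left_diff_distrib)
    qed simp
    also have "\<dots> = R b"
      using sum.remove[OF finite_B that, of "\<lambda>c. coord (R b) c *s c"]
      by (simp add: diag[OF that] expand)
    finally show ?thesis .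
  qed
  moreover have "lin (\<lambda>h. K (P h) - P (K h))"
    by (simp add: lin_iff lin_simps[OF P] lin_simps[OF lin_K] algebra_simps)
  ultimately show ?thesis using that[OF P] lin_eqI[OF _ R] by blast
qed

lemma commutator_kernel_diagonal:
  assumes P: "lin P" and comm: "\<And>h. K (P h) = P (K h)" and b: "b \<in> B"
  shows "P b = coord (P b) b *s b"
proof -
  have "coord (P b) c = 0" if "c \<in> B" "c \<noteq> b" for c
  proof -
    have "(\<kappa> c - \<kappa> b) * coord (P b) c = 0"
      using coord_commutator[OF P b \<open>c \<in> B\<close>] by (simp add: comm coord_simps)
    moreover have "\<kappa> c \<noteq> \<kappa> b" using inj_\<kappa> that b by (auto simp: inj_on_def)
    ultimately show ?thesis by simp
  qed
  then have "P b = (\<Sum>c\<in>B. if c = b then coord (P b) b *s b else 0)"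
    by (subst expand[symmetric]) (rule sum.cong, auto)
  then show ?thesis using b finite_B by simp
qed

section \<open>Solving the normalized recursion\<close>

text \<open>
  The condition on \<open>Q = P\<^sub>n\<close> under which the recursion step can be solved for \<open>P\<^sub>n\<^sub>+\<^sub>1\<close>, namely that
  its right-hand side lies in the image of the commutator with \<open>K\<close>.
\<close>

definition solvable :: "('b \<Rightarrow> 'b) \<Rightarrow> ('b \<Rightarrow> 'b) \<Rightarrow> nat \<Rightarrow> ('b \<Rightarrow> 'b) \<Rightarrow> bool" where
  "solvable G G' n Q \<longleftrightarrow>
     lin Q \<and> (\<forall>b\<in>B. coord (Q (G b) - G' (Q b) - of_nat n *s Q b) b = 0)"

text \<open>
  Any solution \<open>P0\<close> of the commutator equation may be changed by a diagonal operator \<open>D\<close>. The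
  diagonal of \<open>D G - G' D\<close> vanishes as \<open>G\<close> and \<open>G'\<close> have the same diagonal, so the solvability of
  the next step amounts to \<open>(n + 1) D\<close> having the diagonal of \<open>P0 G - G' P0 - (n + 1) P0\<close>.
\<close>

lemma recursion_step_exists:
  assumes G: "lin G" "lin G'" and diag: "\<And>b. b \<in> B \<Longrightarrow> coord (G b) b = coord (G' b) b"
    and Q: "solvable G G' n Q"
  obtains P where "solvable G G' (Suc n) P"
    "\<And>h. K (P h) - P (K h) = Q (G h) - G' (Q h) - of_nat n *s Q h"
proof -
  have linQ: "lin Q" using Q by (simp add: solvable_def)
  have linR: "lin (\<lambda>h. Q (G h) - G' (Q h) - of_nat n *s Q h)"
    by (simp add: lin_iff lin_simps[OF linQ] lin_simps[OF G(1)] lin_simps[OF G(2)] algebra_simps)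
  obtain P0 where P0: "lin P0"
    and eq: "\<And>h. K (P0 h) - P0 (K h) = Q (G h) - G' (Q h) - of_nat n *s Q h"
    using commutator_surj_off_diagonal[OF linR] Q unfolding solvable_def by blast
  define d where "d b = coord (P0 (G b) - G' (P0 b) - of_nat (Suc n) *s P0 b) b / of_nat (Suc n)" for b
  obtain D where D: "lin D" "\<And>b. b \<in> B \<Longrightarrow> D b = d b *s b"
    using lin_extend[of "\<lambda>b. d b *s b"] by blast
  have linP: "lin (\<lambda>h. P0 h + D h)"
    by (simp add: lin_iff lin_simps[OF P0] lin_simps[OF D(1)] algebra_simps)
  show ?thesis
  proof
    show "solvable G G' (Suc n) (\<lambda>h. P0 h + D h)"
      unfolding solvable_def
    proof (intro conjI ballI linP)
      fix b assume b: "b \<in> B"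
      have "coord (P0 (G b) + D (G b) - G' (P0 b + D b) - of_nat (Suc n) *s (P0 b + D b)) b
        = coord (P0 (G b) - G' (P0 b) - of_nat (Suc n) *s P0 b) b - of_nat (Suc n) * d b"
        by (simp add: lin_simps[OF G(2)] coord_simps D(2)[OF b] coord_diagonal[OF D b] diag[OF b]
          coord_basis[OF b] algebra_simps del: of_nat_Suc)
      then show "coord (P0 (G b) + D (G b) - G' (P0 b + D b) - of_nat (Suc n) *s (P0 b + D b)) b = 0"
        by (simp add: d_def del: of_nat_Suc)
    qed
    have "K (D b) - D (K b) = 0" if "b \<in> B" for b
      by (simp add: D(2)[OF that] K_eigen[OF that] lin_simps[OF D(1)] lin_simps[OF lin_K] mult.commute)
    moreover have "lin (\<lambda>h. K (D h) - D (K h))" "lin (\<lambda>h. 0)"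
      by (simp_all add: lin_iff lin_simps[OF D(1)] lin_simps[OF lin_K] algebra_simps)
    ultimately have "K (D h) - D (K h) = 0" for h
      using lin_eqI by blast
    then show "K (P0 h + D h) - (P0 (K h) + D (K h)) = Q (G h) - G' (Q h) - of_nat n *s Q h" for h
      unfolding eq[symmetric] by (simp add: lin_simps[OF lin_K] algebra_simps)
  qed
qed

lemma recursion_solution_exists:
  assumes G: "lin G" "lin G'" and diag: "\<And>b. b \<in> B \<Longrightarrow> coord (G b) b = coord (G' b) b"
  obtains P where "\<And>n. lin (P n)" "P 0 = id" "gauge_recursion K G K G' P"
proof -
  let ?step = "\<lambda>n Q P. \<forall>h. K (P h) - P (K h) = Q (G h) - G' (Q h) - of_nat n *s Q h"
  have 0: "solvable G G' 0 id"
    by (simp add: solvable_def lin_iff coord_simps diag)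
  have "\<exists>P. solvable G G' (Suc n) P \<and> ?step n Q P" if "solvable G G' n Q" for n Q
    using recursion_step_exists[OF G diag that] by blast
  then have "\<exists>P. \<forall>n. (solvable G G' n (P n) \<and> (n = 0 \<longrightarrow> P n = id)) \<and> ?step n (P n) (P (Suc n))"
    by (intro dependent_nat_choice) (use 0 in \<open>auto simp: id_def\<close>)
  then obtain P where "\<And>n. solvable G G' n (P n)" "P 0 = id" "\<And>n. ?step n (P n) (P (Suc n))"
    by blast
  then show ?thesis using that[of P] by (auto simp: solvable_def gauge_recursion_def)
qed

text \<open>
  The first step of the recursion reads \<open>[K, P\<^sub>1] = G - G'\<close>, and a commutator with \<open>K\<close> has zero
  diagonal.
\<close>

lemma recursion_diag:
  assumes "\<And>n. lin (P n)" "P 0 = id" "gauge_recursion K G K G' P" "b \<in> B"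
  shows "coord (G b) b = coord (G' b) b"
proof -
  have "K (P 1 b) - P 1 (K b) = G b - G' b"
    using assms(2,3) by (auto simp: gauge_recursion_def dest!: spec[of _ "0::nat"])
  then show ?thesis
    using coord_commutator[OF assms(1)[of 1] assms(4,4)] by (simp add: coord_simps)
qed

text \<open>
  The difference \<open>E\<close> of two solutions satisfies the same linear recursion with \<open>E\<^sub>0 = 0\<close>. If
  \<open>E\<^sub>n = 0\<close>, then \<open>E\<^sub>n\<^sub>+\<^sub>1\<close> commutes with \<open>K\<close> and hence is diagonal. As \<open>G\<close> and \<open>G'\<close> have the same
  diagonal, the diagonal of the following step then reads \<open>0 = - (n + 1) E\<^sub>n\<^sub>+\<^sub>1\<close>.
\<close>

lemma recursion_solution_unique:
  assumes P: "\<And>n. lin (P n)" "P 0 = id" "gauge_recursion K G K G' P"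
    and Q: "\<And>n. lin (Q n)" "Q 0 = id" "gauge_recursion K G K G' Q"
    and G: "lin G" "lin G'"
  shows "P = Q"
proof -
  note diag = recursion_diag[OF P]
  have "P n = Q n" for n
  proof (induction n)
    case 0
    then show ?case using P(2) Q(2) by simp
  next
    case (Suc n)
    let ?E = "\<lambda>n h. P n h - Q n h"
    have linE: "lin (?E n)" for n
      by (simp add: lin_iff lin_simps[OF P(1)] lin_simps[OF Q(1)] algebra_simps)
    have E: "K (?E (Suc n) h) - ?E (Suc n) (K h) = ?E n (G h) - G' (?E n h) - of_nat n *s ?E n h" for n h
    proof -
      have "K (P (Suc n) h) - P (Suc n) (K h) = P n (G h) - G' (P n h) - of_nat n *s P n h"
        "K (Q (Suc n) h) - Q (Suc n) (K h) = Q n (G h) - G' (Q n h) - of_nat n *s Q n h"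
        using P(3) Q(3) by (simp_all add: gauge_recursion_def)
      moreover have "K (?E (Suc n) h) - ?E (Suc n) (K h)
          = (K (P (Suc n) h) - P (Suc n) (K h)) - (K (Q (Suc n) h) - Q (Suc n) (K h))"
        by (simp add: lin_simps(5)[OF lin_K])
      ultimately show ?thesis
        by (simp add: lin_simps(5)[OF G(2)] scale_right_diff_distrib)
    qed
    have comm: "K (?E (Suc n) h) = ?E (Suc n) (K h)" for h
      using E[of n h] by (simp add: Suc.IH lin_simps[OF G(2)])
    define d where "d b = coord (?E (Suc n) b) b" for b
    have D: "?E (Suc n) b = d b *s b" if "b \<in> B" for b
      unfolding d_def by (rule commutator_kernel_diagonal[OF linE comm that])
    have "?E (Suc n) b = 0" if b: "b \<in> B" for b
    proof -
      \<comment> \<open>Step \<open>n\<close> leaves the diagonal of \<open>E\<^sub>n\<^sub>+\<^sub>1\<close> free; it is forced to vanish by step \<open>n + 1\<close>.\<close>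
      have "0 = coord (K (?E (Suc (Suc n)) b) - ?E (Suc (Suc n)) (K b)) b"
        by (subst coord_commutator[OF linE b b]) simp
      also have "\<dots> = - (of_nat (Suc n) * d b)"
        unfolding E[of "Suc n"]
        using coord_diagonal[OF linE D b]
        by (simp add: D[OF b] coord_simps lin_simps[OF G(2)] coord_basis[OF b] diag[OF b] del: of_nat_Suc)
      finally have "d b = 0" by (simp del: of_nat_Suc)
      then show ?thesis using D[OF b] by simp
    qed
    then have "P (Suc n) b = Q (Suc n) b" if "b \<in> B" for b
      using that by (simp only: right_minus_eq)
    then have "P (Suc n) h = Q (Suc n) h" for h by (rule lin_eqI[OF P(1) Q(1)])
    then show ?case by (rule ext)
  qed
  then show ?thesis by (rule ext)
qed

section \<open>Gauge equivalences and their initial values\<close>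

text \<open>
  Composing with the constant gauge transformation \<open>\<phi>\<^sup>-\<^sup>1\<close> replaces \<open>K'\<close> and \<open>G'\<close> by their conjugates,
  which reduces everything to \<open>K' = K\<close> and \<open>P\<^sub>0 = 1\<close>.
\<close>

lemma gauge_recursion_conjugate:
  assumes "lin \<phi>" "bij \<phi>" "K = inv \<phi> \<circ> K' \<circ> \<phi>"
  shows "gauge_recursion K G K' G' P \<longleftrightarrow>
    gauge_recursion K G K (inv \<phi> \<circ> G' \<circ> \<phi>) (\<lambda>n. inv \<phi> \<circ> P n)"
proof -
  have s: "\<phi> (inv \<phi> x) = x" and i: "inv \<phi> x = inv \<phi> y \<longleftrightarrow> x = y" for x y
    using assms(2) by (auto simp: bij_is_surj surj_f_inv_f dest: bij_imp_bij_inv bij_is_inj injD)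
  note simps = lin_simps[OF lin_inv[OF assms(1,2)], symmetric]
  show ?thesis
    by (simp add: gauge_recursion_def assms(3) s i simps)
qed

lemma gauge_equivalence_exists:
  assumes lin: "lin G" "lin K'" "lin G'"
    and framed: "framed_by scale nabla K G" "framed_by scale nabla' K' G'"
    and \<phi>: "lin \<phi>" "bij \<phi>" "K = inv \<phi> \<circ> K' \<circ> \<phi>"
    and diag: "\<And>b. b \<in> B \<Longrightarrow> diag_entry scale B G b = diag_entry scale B (inv \<phi> \<circ> G' \<circ> \<phi>) b"
  shows "\<exists>\<Phi>. gauge_equivalence scale nabla nabla' \<Phi> \<and> at_zero \<Phi> = \<phi>"
proof -
  have linG: "lin (inv \<phi> \<circ> G' \<circ> \<phi>)"
    by (simp add: lin_iff lin_simps[OF lin_inv[OF \<phi>(1,2)]] lin_simps[OF lin(3)] lin_simps[OF \<phi>(1)])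
  obtain Q where Q: "\<And>n. lin (Q n)" "Q 0 = id" "gauge_recursion K G K (inv \<phi> \<circ> G' \<circ> \<phi>) Q"
    using recursion_solution_exists[OF lin(1) linG] diag by (auto simp: diag_entry_def)
  let ?P = "\<lambda>n. \<phi> \<circ> Q n"
  have linP: "lin (?P n)" for n
    by (simp add: lin_iff lin_simps[OF \<phi>(1)] lin_simps[OF Q(1)])
  have "inv \<phi> \<circ> ?P n = Q n" for n
    using \<phi>(2) by (simp add: fun_eq_iff bij_is_inj)
  then have "gauge_recursion K G K' G' ?P"
    using Q(3) by (simp add: gauge_recursion_conjugate[OF \<phi>])
  then have "gauge_equivalence scale nabla nabla' (fps_op ?P)"
    by (simp add: gauge_equivalence_fps_op_iff[OF linP lin(2,3) lin_K lin(1) framed] Q(2) \<phi>(2))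
  moreover have "at_zero (fps_op ?P) = \<phi>" by (simp add: at_zero_fps_op Q(2))
  ultimately show ?thesis by blast
qed

text \<open>
  Splitting off the initial value leaves a gauge transformation with initial value 1, to which the
  results on the normalized recursion apply.
\<close>

lemma gauge_equivalence_normalized:
  assumes lin: "lin G" "lin K'" "lin G'"
    and framed: "framed_by scale nabla K G" "framed_by scale nabla' K' G'"
    and \<Phi>: "gauge_equivalence scale nabla nabla' \<Phi>"
  obtains Q where "\<And>n. lin (Q n)" "Q 0 = id"
    "gauge_recursion K G K (inv (at_zero \<Phi>) \<circ> G' \<circ> at_zero \<Phi>) Q"
    "\<Phi> = fps_op (\<lambda>n. at_zero \<Phi> \<circ> Q n)"
    "lin (at_zero \<Phi>)" "bij (at_zero \<Phi>)" "K = inv (at_zero \<Phi>) \<circ> K' \<circ> at_zero \<Phi>"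
proof -
  have "fps_lin \<Phi>" using \<Phi> by (simp add: gauge_equivalence_def GL_fps_def)
  then obtain P where P: "\<And>n. lin (P n)" "\<Phi> = fps_op P" using fps_lin_eq_fps_op by blast
  let ?\<phi> = "at_zero \<Phi>"
  have \<phi>: "?\<phi> = P 0" by (simp add: P at_zero_fps_op)
  have rec: "bij (P 0)" "gauge_recursion K G K' G' P"
    using \<Phi> by (simp_all add: P(2) gauge_equivalence_fps_op_iff[OF P(1) lin(2,3) lin_K lin(1) framed])
  have inv: "inv (P 0) (P 0 h) = h" "P 0 (inv (P 0) h) = h" for h
    using rec(1) by (simp_all add: bij_is_inj bij_is_surj surj_f_inv_f)
  have K: "K = inv ?\<phi> \<circ> K' \<circ> ?\<phi>"
    using rec(2) by (simp add: \<phi> fun_eq_iff gauge_recursion_def inv)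
  have lin\<phi>: "lin ?\<phi>" "bij ?\<phi>" by (simp_all add: \<phi> P(1) rec(1))
  show ?thesis
  proof (rule that[of "\<lambda>n. inv ?\<phi> \<circ> P n"])
    show "lin (inv ?\<phi> \<circ> P n)" for n
      by (simp add: lin_iff lin_simps[OF lin_inv[OF lin\<phi>]] lin_simps[OF P(1)])
    show "inv ?\<phi> \<circ> P 0 = id" by (simp add: \<phi> fun_eq_iff inv)
    show "gauge_recursion K G K (inv ?\<phi> \<circ> G' \<circ> ?\<phi>) (\<lambda>n. inv ?\<phi> \<circ> P n)"
      using rec(2) gauge_recursion_conjugate[OF lin\<phi> K] by blast
    have *: "(\<lambda>n. ?\<phi> \<circ> (inv ?\<phi> \<circ> P n)) = P" by (simp add: \<phi> fun_eq_iff inv)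
    show "\<Phi> = fps_op (\<lambda>n. ?\<phi> \<circ> (inv ?\<phi> \<circ> P n))" unfolding * by (rule P(2))
  qed (use lin\<phi> K in auto)
qed

lemma gauge_equivalence_at_zero:
  assumes lin: "lin G" "lin K'" "lin G'"
    and framed: "framed_by scale nabla K G" "framed_by scale nabla' K' G'"
    and \<Phi>: "gauge_equivalence scale nabla nabla' \<Phi>"
  shows "at_zero \<Phi> \<in> GL scale" "K = inv (at_zero \<Phi>) \<circ> K' \<circ> at_zero \<Phi>"
    "b \<in> B \<Longrightarrow> diag_entry scale B G b = diag_entry scale B (inv (at_zero \<Phi>) \<circ> G' \<circ> at_zero \<Phi>) b"
proof -
  obtain Q where Q: "\<And>n. lin (Q n)" "Q 0 = id"
    "gauge_recursion K G K (inv (at_zero \<Phi>) \<circ> G' \<circ> at_zero \<Phi>) Q"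
    and \<phi>: "lin (at_zero \<Phi>)" "bij (at_zero \<Phi>)" "K = inv (at_zero \<Phi>) \<circ> K' \<circ> at_zero \<Phi>"
    using gauge_equivalence_normalized[OF assms] by metis
  show "at_zero \<Phi> \<in> GL scale" using \<phi> by (simp add: GL_def)
  show "K = inv (at_zero \<Phi>) \<circ> K' \<circ> at_zero \<Phi>" by fact
  show "diag_entry scale B G b = diag_entry scale B (inv (at_zero \<Phi>) \<circ> G' \<circ> at_zero \<Phi>) b" if "b \<in> B"
    using recursion_diag[OF Q that] by (simp add: diag_entry_def)
qed

lemma gauge_equivalence_unique:
  assumes lin: "lin G" "lin K'" "lin G'"
    and framed: "framed_by scale nabla K G" "framed_by scale nabla' K' G'"
    and \<Phi>: "gauge_equivalence scale nabla nabla' \<Phi>"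
    and \<Psi>: "gauge_equivalence scale nabla nabla' \<Psi>"
    and eq: "at_zero \<Phi> = at_zero \<Psi>"
  shows "\<Phi> = \<Psi>"
proof -
  obtain P where P: "\<And>n. lin (P n)" "P 0 = id"
    "gauge_recursion K G K (inv (at_zero \<Phi>) \<circ> G' \<circ> at_zero \<Phi>) P"
    and P': "\<Phi> = fps_op (\<lambda>n. at_zero \<Phi> \<circ> P n)"
    and \<phi>: "lin (at_zero \<Phi>)" "bij (at_zero \<Phi>)"
    using gauge_equivalence_normalized[OF lin framed \<Phi>] by metis
  obtain Q where Q: "\<And>n. lin (Q n)" "Q 0 = id"
    "gauge_recursion K G K (inv (at_zero \<Phi>) \<circ> G' \<circ> at_zero \<Phi>) Q"
    and Q': "\<Psi> = fps_op (\<lambda>n. at_zero \<Phi> \<circ> Q n)"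
    unfolding eq using gauge_equivalence_normalized[OF lin framed \<Psi>] by metis
  have "lin (inv (at_zero \<Phi>) \<circ> G' \<circ> at_zero \<Phi>)"
    by (simp add: lin_iff lin_simps[OF lin_inv[OF \<phi>]] lin_simps[OF lin(3)] lin_simps[OF \<phi>(1)])
  then have "P = Q"
    using recursion_solution_unique[OF P Q lin(1)] by blast
  then show ?thesis using P' Q' by simp
qed

end

theorem proposition1p6:
  fixes scale :: "'k::field_char_0 \<Rightarrow> 'h::ab_group_add \<Rightarrow> 'h"
    and Basis :: "'h set"
    and m :: nat
    and nabla nabla' :: "'h fps \<Rightarrow> 'h fls"
    and K G K' G' :: "'h \<Rightarrow> 'h"
  assumes "finite_dimensional_vector_space scale Basis"
    and "vector_space.dim scale (UNIV :: 'h set) = m"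
    and "Vector_Spaces.linear scale scale K" and "Vector_Spaces.linear scale scale G"
    and "Vector_Spaces.linear scale scale K'" and "Vector_Spaces.linear scale scale G'"
    and "F_bundle scale nabla" and "F_bundle scale nabla'"
    and "framed_by scale nabla K G" and "framed_by scale nabla' K' G'"
    and "card (eigenvalues scale K) = m"
  shows "(\<exists>B. eigenbasis scale K B) \<and>
    (\<forall>B. eigenbasis scale K B \<longrightarrow>
      (F_bundles_isomorphic scale nabla nabla' \<longleftrightarrow>
        (\<exists>\<phi>\<in>GL scale. K = inv \<phi> \<circ> K' \<circ> \<phi> \<and>
          (\<forall>b\<in>B. diag_entry scale B G b = diag_entry scale B (inv \<phi> \<circ> G' \<circ> \<phi>) b))) \<and>
      (\<forall>\<phi>\<in>GL scale. K = inv \<phi> \<circ> K' \<circ> \<phi> \<and>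
          (\<forall>b\<in>B. diag_entry scale B G b = diag_entry scale B (inv \<phi> \<circ> G' \<circ> \<phi>) b) \<longrightarrow>
        (\<exists>!\<Phi>. gauge_equivalence scale nabla nabla' \<Phi> \<and> at_zero \<Phi> = \<phi>))) \<and>
    (\<forall>\<Phi> \<Psi>. gauge_equivalence scale nabla nabla' \<Phi> \<and> gauge_equivalence scale nabla nabla' \<Psi> \<and>
        at_zero \<Phi> = at_zero \<Psi> \<longrightarrow> \<Phi> = \<Psi>)"
proof -
  interpret finite_dimensional_vector_space scale Basis by fact
  interpret char_0_space scale Basis by unfold_locales
  note lin = assms(4-6) and framed = assms(9,10)
  have card: "card (eigenvalues scale K) = dim UNIV" using assms(2,11) by simp
  have spectrum: "\<exists>\<kappa>. simple_spectrum scale Basis K B \<kappa>" if "eigenbasis scale K B" for B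
  proof -
    from that obtain \<kappa> where \<kappa>: "\<And>b. b \<in> B \<Longrightarrow> K b = scale (\<kappa> b) b"
      unfolding eigenbasis_def by metis
    have B: "independent B" "span B = UNIV" using that by (auto simp: eigenbasis_def)
    have "inj_on \<kappa> B"
      by (rule eigenbasis_distinct_eigenvalues[OF assms(3) card B \<kappa>])
    then have "simple_spectrum scale Basis K B \<kappa>"
      using assms(3) B \<kappa> char_0_space_axioms
      by (intro simple_spectrum.intro simple_spectrum_axioms.intro)
    then show ?thesis by blast
  qed
  obtain B0 where B0: "eigenbasis scale K B0" using eigenbasis_exists[OF assms(3) card] by blast
  then obtain \<kappa>0 where "simple_spectrum scale Basis K B0 \<kappa>0" using spectrum by blast
  note unique = simple_spectrum.gauge_equivalence_unique[OF this lin framed]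
  show ?thesis
  proof (intro conjI allI impI)
    show "\<exists>B. eigenbasis scale K B" using B0 by blast
    show "\<Phi> = \<Psi>" if "gauge_equivalence scale nabla nabla' \<Phi> \<and>
        gauge_equivalence scale nabla nabla' \<Psi> \<and> at_zero \<Phi> = at_zero \<Psi>" for \<Phi> \<Psi>
      using that unique by blast
  next
    fix B assume "eigenbasis scale K B"
    then obtain \<kappa> where "simple_spectrum scale Basis K B \<kappa>" using spectrum by blast
    then interpret simple_spectrum scale Basis K B \<kappa> .
    have ex: "\<exists>\<Phi>. gauge_equivalence scale nabla nabla' \<Phi> \<and> at_zero \<Phi> = \<phi>"
      if "\<phi> \<in> GL scale" "K = inv \<phi> \<circ> K' \<circ> \<phi> \<and>
        (\<forall>b\<in>B. diag_entry scale B G b = diag_entry scale B (inv \<phi> \<circ> G' \<circ> \<phi>) b)" for \<phi>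
      using that by (intro gauge_equivalence_exists[OF lin framed]) (auto simp: GL_def)
    show "F_bundles_isomorphic scale nabla nabla' \<longleftrightarrow>
        (\<exists>\<phi>\<in>GL scale. K = inv \<phi> \<circ> K' \<circ> \<phi> \<and>
          (\<forall>b\<in>B. diag_entry scale B G b = diag_entry scale B (inv \<phi> \<circ> G' \<circ> \<phi>) b))"
      unfolding F_bundles_isomorphic_def
      using ex gauge_equivalence_at_zero[OF lin framed] by metis
    show "\<forall>\<phi>\<in>GL scale. K = inv \<phi> \<circ> K' \<circ> \<phi> \<and>
          (\<forall>b\<in>B. diag_entry scale B G b = diag_entry scale B (inv \<phi> \<circ> G' \<circ> \<phi>) b) \<longrightarrow>
        (\<exists>!\<Phi>. gauge_equivalence scale nabla nabla' \<Phi> \<and> at_zero \<Phi> = \<phi>)"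
      using ex unique by blast
  qed
qed

end
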